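(* Let $\tau>0$, let $j\ge0$ be an integer, and put $t_s=s\tau$ for $s\ge 0$ (integer or half-integer). For all $\alpha\in(0,1)$ and $u\in C^2[0,t_{j+1}]$, $$\left|\partial^{\alpha}_{0t_{j+1/2}}u-\Delta^{\alpha}_{0t_{j+1/2}}u\right|\le\frac{2^{\alpha}M_2^{j+1}}{4\,\Gamma(2-\alpha)}\left(\frac{1-\alpha}{2}+1\right)\tau^{2-\alpha},$$ where $M_2^{j+1}=\sup_{0<t<t_{j+1}}|u''(t)|$.
   Context: $\partial^{\alpha}_{0t_{j+1/2}}u$ is the Caputo fractional derivative of order $\alpha$ at $t_{j+1/2}=(j+\tfrac12)\tau$: $$\partial^{\alpha}_{0t_{j+1/2}}u=\frac1{\Gamma(1-\alpha)}\int_0^{t_{j+1/2}}\frac{u'(\eta)}{(t_{j+1/2}-\eta)^{\alpha}}\,d\eta.$$ Its difference analog is $$\Delta^{\alpha}_{0t_{j+1/2}}u=\frac{\tau^{1-\alpha}}{\Gamma(2-\alpha)}\sum_{s=0}^{j}c^{(\alpha)}_{j-s}\,\frac{u(t_{s+1})-u(t_s)}{\tau},$$ with $c_0^{(\alpha)}=\dfrac1{2^{1-\alpha}}$ and $c_n^{(\alpha)}=(n+\tfrac12)^{1-\alpha}-(n-\tfrac12)^{1-\alpha}$ for $n\ge1$. *)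

theory Defs
  imports "HOL-Analysis.Analysis"
begin

definition mesh_point :: "real \<Rightarrow> real \<Rightarrow> real" where
  "mesh_point \<tau> s = s * \<tau>"

text \<open>Twice continuously differentiable on the closed interval from \<open>a\<close> to \<open>b\<close>, for \<open>a < b\<close>:
  derivatives at the endpoints are one-sided and \<open>u\<close> is unconstrained outside the interval.\<close>

definition C2_on_interval :: "real \<Rightarrow> real \<Rightarrow> (real \<Rightarrow> real) \<Rightarrow> bool" where
  "C2_on_interval a b u \<longleftrightarrow>
     (\<exists>u' u''. (\<forall>x\<in>{a..b}. (u has_real_derivative u' x) (at x within {a..b})) \<and>
               (\<forall>x\<in>{a..b}. (u' has_real_derivative u'' x) (at x within {a..b})) \<and>
               continuous_on {a..b} u'')"

text \<open>In the integrand, the value of \<^term>\<open>deriv u\<close> at \<open>0\<close> (where only a one-sided derivative need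
  exist) and the value of the quotient at \<open>t\<close> (where the denominator vanishes) do not affect the
  integral.\<close>

definition caputo :: "real \<Rightarrow> real \<Rightarrow> (real \<Rightarrow> real) \<Rightarrow> real" where
  "caputo \<alpha> t u =
     1 / Gamma (1 - \<alpha>) * integral {0..t} (\<lambda>\<eta>. deriv u \<eta> / (t - \<eta>) powr \<alpha>)"

definition caputo_coeff :: "real \<Rightarrow> nat \<Rightarrow> real" where
  "caputo_coeff \<alpha> n =
     (if n = 0 then 1 / 2 powr (1 - \<alpha>)
      else (real n + 1/2) powr (1 - \<alpha>) - (real n - 1/2) powr (1 - \<alpha>))"

definition discrete_caputo :: "real \<Rightarrow> real \<Rightarrow> nat \<Rightarrow> (real \<Rightarrow> real) \<Rightarrow> real" where
  "discrete_caputo \<alpha> \<tau> j u =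
     \<tau> powr (1 - \<alpha>) / Gamma (2 - \<alpha>) *
       (\<Sum>s=0..j. caputo_coeff \<alpha> (j - s) *
          ((u (mesh_point \<tau> (real (s + 1))) - u (mesh_point \<tau> (real s))) / \<tau>))"

definition sup_abs_deriv2 :: "real \<Rightarrow> (real \<Rightarrow> real) \<Rightarrow> real" where
  "sup_abs_deriv2 T u = (SUP t\<in>{0<..<T}. \<bar>(deriv ^^ 2) u t\<bar>)"

end

theory Submission imports Defs begin

text \<open>With \<open>T = t\<^sub>j\<^sub>+\<^sub>1\<^sub>/\<^sub>2\<close>, the difference formula is the Caputo integral of the piecewise linear
  interpolant of \<open>u\<close>. On each cell left of \<open>t\<^sub>j\<close> integrate by parts, so that the kernel derivative
  \<open>\<alpha> (T - \<eta>) powr (- \<alpha> - 1)\<close> is tested against an interpolation error of size at most \<open>M \<tau>\<^sup>2 / 8\<close>;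
  these bounds telescope to \<open>M \<tau>\<^sup>2 / 8 * (\<tau> / 2) powr - \<alpha>\<close>. On the final half cell the kernel is
  singular, and there the slope of the interpolant is within \<open>M \<tau> / 2\<close> of \<open>u'\<close>.\<close>

section \<open>Taylor and linear interpolation bounds under a bound on the second derivative\<close>

lemma mvt_within:
  fixes f f' :: "real \<Rightarrow> real"
  assumes "a < b" and "\<And>x. x \<in> {a..b} \<Longrightarrow> (f has_real_derivative f' x) (at x within {a..b})"
  obtains \<xi> where "\<xi> \<in> {a<..<b}" "f b - f a = f' \<xi> * (b - a)"
  using mvt_simple[of a b f "\<lambda>x. (*) (f' x)"] assms
  by (auto simp: has_field_derivative_def)

text \<open>A nonnegative \<open>f''\<close> makes \<open>f'\<close> monotone by the mean value
  theorem. A second use, on \<open>f\<close> between \<open>x\<close> and \<open>y\<close>, then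
  compares the secant slope with \<open>f' x\<close>; both orders of \<open>x\<close> and
  \<open>y\<close> give the same inequality. The sign of \<open>f''\<close> is asked for on the open
  interval only, which matches a supremum taken over interior points.\<close>

lemma tangent_le:
  fixes f f' f'' :: "real \<Rightarrow> real"
  assumes df: "\<And>x. x \<in> {a..b} \<Longrightarrow> (f has_real_derivative f' x) (at x within {a..b})"
    and df': "\<And>x. x \<in> {a..b} \<Longrightarrow> (f' has_real_derivative f'' x) (at x within {a..b})"
    and pos: "\<And>x. x \<in> {a<..<b} \<Longrightarrow> f'' x \<ge> 0"
    and x: "x \<in> {a..b}" and y: "y \<in> {a..b}"
  shows "f x + f' x * (y - x) \<le> f y"
proof -
  have mono: "f' p \<le> f' q" if pq: "p \<in> {a..b}" "q \<in> {a..b}" "p \<le> q" for p q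
  proof (cases "p = q")
    case False
    from False pq(3) have "p < q"
      by simp
    then obtain \<xi> where "\<xi> \<in> {p<..<q}" "f' q - f' p = f'' \<xi> * (q - p)"
      by (rule mvt_within[of p q f' f'']) (use pq in \<open>auto intro: DERIV_subset[OF df']\<close>)
    moreover from this pq have "f'' \<xi> * (q - p) \<ge> 0"
      by (intro mult_nonneg_nonneg pos) auto
    ultimately show ?thesis by linarith
  qed auto
  consider "x = y" | "x < y" | "y < x" by linarith
  then show ?thesis
  proof cases
    case 2
    obtain \<xi> where \<xi>: "\<xi> \<in> {x<..<y}" "f y - f x = f' \<xi> * (y - x)"
      by (rule mvt_within[of x y f f']) (use 2 x y in \<open>auto intro: DERIV_subset[OF df]\<close>)
    have "f' x * (y - x) \<le> f' \<xi> * (y - x)"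
      using \<xi> x y 2 by (intro mult_right_mono mono) auto
    with \<xi> show ?thesis by linarith
  next
    case 3
    obtain \<xi> where \<xi>: "\<xi> \<in> {y<..<x}" "f x - f y = f' \<xi> * (x - y)"
      by (rule mvt_within[of y x f f']) (use 3 x y in \<open>auto intro: DERIV_subset[OF df]\<close>)
    have "f' \<xi> * (x - y) \<le> f' x * (x - y)"
      using \<xi> x y 3 by (intro mult_right_mono mono) auto
    with \<xi> show ?thesis by (simp add: algebra_simps)
  qed auto
qed

text \<open>Both \<open>M * x\<^sup>2 / 2 + u x\<close> and \<open>M * x\<^sup>2 / 2 - u x\<close>
  have nonnegative second derivative, so each lies above its tangents. The quadratic exceeds its own
  tangent at \<open>x\<close> by exactly \<open>M / 2 * (y - x)\<^sup>2\<close>, and the two signs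
  of \<open>u\<close> give the two sides of the absolute value.\<close>

lemma first_order_taylor_bound:
  fixes u u' u'' :: "real \<Rightarrow> real"
  assumes du: "\<And>x. x \<in> {a..b} \<Longrightarrow> (u has_real_derivative u' x) (at x within {a..b})"
    and du': "\<And>x. x \<in> {a..b} \<Longrightarrow> (u' has_real_derivative u'' x) (at x within {a..b})"
    and bd: "\<And>x. x \<in> {a<..<b} \<Longrightarrow> \<bar>u'' x\<bar> \<le> M"
    and x: "x \<in> {a..b}" and y: "y \<in> {a..b}"
  shows "\<bar>u y - u x - u' x * (y - x)\<bar> \<le> M / 2 * (y - x)\<^sup>2"
proof -
  have "(M * x\<^sup>2 / 2 + c * u x) + (M * x + c * u' x) * (y - x) \<le> M * y\<^sup>2 / 2 + c * u y"
    if c: "c = 1 \<or> c = -1" for c :: real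
  proof (rule tangent_le[where a = a and b = b and f'' = "\<lambda>x. M + c * u'' x"])
    show "((\<lambda>x. M * x\<^sup>2 / 2 + c * u x) has_real_derivative M * t + c * u' t) (at t within {a..b})"
      if "t \<in> {a..b}" for t
      using du[OF that] by (auto intro!: derivative_eq_intros)
    show "((\<lambda>x. M * x + c * u' x) has_real_derivative M + c * u'' t) (at t within {a..b})"
      if "t \<in> {a..b}" for t
      using du'[OF that] by (auto intro!: derivative_eq_intros)
    show "0 \<le> M + c * u'' t" if "t \<in> {a<..<b}" for t
      using bd[OF that] c by auto
  qed (use x y in auto)
  from this[of 1] this[of "-1"] show ?thesis
    by (simp add: abs_le_iff power2_eq_square algebra_simps)
qed

text \<open>Expand \<open>u\<close> about \<open>x\<close> towards both endpoints, with remainders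
  \<open>R a\<close> and \<open>R b\<close>. Weighting them by \<open>b - x\<close> and
  \<open>x - a\<close> cancels \<open>u' x\<close> and leaves the interpolation error; subtracting
  them cancels \<open>u x\<close> and leaves the slope error.\<close>

lemma linear_interpolation_error:
  fixes u u' u'' :: "real \<Rightarrow> real"
  assumes "a < b"
    and du: "\<And>x. x \<in> {a..b} \<Longrightarrow> (u has_real_derivative u' x) (at x within {a..b})"
    and du': "\<And>x. x \<in> {a..b} \<Longrightarrow> (u' has_real_derivative u'' x) (at x within {a..b})"
    and bd: "\<And>x. x \<in> {a<..<b} \<Longrightarrow> \<bar>u'' x\<bar> \<le> M"
    and x: "x \<in> {a..b}"
  shows "\<bar>u x - u a - (u b - u a) / (b - a) * (x - a)\<bar> \<le> M * (b - a)\<^sup>2 / 8"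
    and "\<bar>u' x - (u b - u a) / (b - a)\<bar> \<le> M * (b - a) / 2"
proof -
  define R where "R y = u y - u x - u' x * (y - x)" for y
  have R: "\<bar>R y\<bar> \<le> M / 2 * (y - x)\<^sup>2" if "y \<in> {a..b}" for y
    unfolding R_def using first_order_taylor_bound[OF du du' bd x that] by simp
  have Ra: "\<bar>R a\<bar> \<le> M / 2 * (x - a)\<^sup>2" and Rb: "\<bar>R b\<bar> \<le> M / 2 * (b - x)\<^sup>2"
    using R[of a] R[of b] \<open>a < b\<close> by (auto simp: power2_commute)
  have M: "M \<ge> 0"
    using bd[of "(a + b) / 2"] \<open>a < b\<close> by fastforce
  have "(b - a) * (u x - u a - (u b - u a) / (b - a) * (x - a)) = - ((b - x) * R a + (x - a) * R b)"
    using \<open>a < b\<close> unfolding R_def by (simp add: divide_simps) algebra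
  then have "(b - a) * \<bar>u x - u a - (u b - u a) / (b - a) * (x - a)\<bar> = \<bar>(b - x) * R a + (x - a) * R b\<bar>"
    using \<open>a < b\<close> by (metis abs_minus_cancel abs_mult abs_of_pos diff_gt_0_iff_gt)
  also have "\<dots> \<le> (b - x) * \<bar>R a\<bar> + (x - a) * \<bar>R b\<bar>"
    using x by (intro order_trans[OF abs_triangle_ineq]) (simp add: abs_mult)
  also have "\<dots> \<le> (b - x) * (M / 2 * (x - a)\<^sup>2) + (x - a) * (M / 2 * (b - x)\<^sup>2)"
    using x by (intro add_mono mult_left_mono Ra Rb) auto
  \<comment> \<open>With p = b - x and q = x - a the sum is M/2 p q (p + q), and 4 p q = (p + q)^2 -
    (p - q)^2. Dropping the last square yields the constant 1/8.\<close>
  also have "\<dots> = (b - a) * (M * ((b - a)\<^sup>2 - ((b - x) - (x - a))\<^sup>2) / 8)"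
    by (simp add: field_simps power2_eq_square)
  also have "\<dots> \<le> (b - a) * (M * (b - a)\<^sup>2 / 8)"
    using \<open>a < b\<close> M by (intro mult_left_mono divide_right_mono) auto
  finally show "\<bar>u x - u a - (u b - u a) / (b - a) * (x - a)\<bar> \<le> M * (b - a)\<^sup>2 / 8"
    using \<open>a < b\<close> by simp
  have "(b - a) * (u' x - (u b - u a) / (b - a)) = R a - R b"
    using \<open>a < b\<close> unfolding R_def by (simp add: field_simps)
  then have "(b - a) * \<bar>u' x - (u b - u a) / (b - a)\<bar> = \<bar>R a - R b\<bar>"
    using \<open>a < b\<close> by (metis abs_mult abs_of_pos diff_gt_0_iff_gt)
  also have "\<dots> \<le> M / 2 * (x - a)\<^sup>2 + M / 2 * (b - x)\<^sup>2"
    using Ra Rb by linarith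
  \<comment> \<open>Here p^2 + q^2 = (p + q)^2 - 2 p q with p, q nonnegative, so the worst case is
    at the endpoints.\<close>
  also have "\<dots> = M / 2 * ((b - a)\<^sup>2 - 2 * ((b - x) * (x - a)))"
    by (simp add: field_simps power2_eq_square)
  also have "\<dots> \<le> M / 2 * (b - a)\<^sup>2"
    using x M by (intro mult_left_mono) auto
  also have "\<dots> = (b - a) * (M * (b - a) / 2)"
    by (simp add: power2_eq_square)
  finally show "\<bar>u' x - (u b - u a) / (b - a)\<bar> \<le> M * (b - a) / 2"
    using \<open>a < b\<close> by simp
qed

section \<open>The kernel integral and the error on the cells\<close>

lemma has_integral_caputo_kernel:
  fixes a b T \<alpha> :: real
  assumes "a \<le> b" "b \<le> T" "\<alpha> < 1"
  shows "((\<lambda>\<eta>. 1 / (T - \<eta>) powr \<alpha>) has_integral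
           ((T - a) powr (1 - \<alpha>) - (T - b) powr (1 - \<alpha>)) / (1 - \<alpha>)) {a..b}"
proof -
  have "((\<lambda>\<eta>. 1 / (T - \<eta>) powr \<alpha>) has_integral
         (- ((T - b) powr (1 - \<alpha>)) / (1 - \<alpha>) - (- ((T - a) powr (1 - \<alpha>)) / (1 - \<alpha>)))) {a..b}"
  proof (rule fundamental_theorem_of_calculus_interior)
    \<comment> \<open>The antiderivative stays continuous at \<open>T\<close> because
      \<open>1 - \<alpha>\<close> is positive, while its derivative is required only in the
      interior. This admits \<open>b = T\<close>, the singular case.\<close>
    show "continuous_on {a..b} (\<lambda>\<eta>. - ((T - \<eta>) powr (1 - \<alpha>)) / (1 - \<alpha>))"
      using assms by (intro continuous_intros continuous_on_powr') auto
    show "((\<lambda>\<eta>. - ((T - \<eta>) powr (1 - \<alpha>)) / (1 - \<alpha>)) has_vector_derivative 1 / (T - x) powr \<alpha>) (at x)"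
      if "x \<in> {a<..<b}" for x
    proof -
      have "((\<lambda>\<eta>. - ((T - \<eta>) powr (1 - \<alpha>)) / (1 - \<alpha>)) has_real_derivative
          (1 - \<alpha>) * (T - x) powr (- \<alpha>) / (1 - \<alpha>)) (at x)"
        using that assms by (auto intro!: derivative_eq_intros)
      then show ?thesis
        using \<open>\<alpha> < 1\<close>
        by (simp add: powr_minus_divide has_real_derivative_iff_has_vector_derivative[symmetric])
    qed
  qed (use assms in auto)
  then show ?thesis
    by (simp add: diff_divide_distrib)
qed

text \<open>Since \<open>b < T\<close>, the kernel \<open>k\<close> is smooth on the cell. The error
  \<open>e\<close> of the interpolant vanishes at both ends, so integration by parts turns the
  integral of (u' - D) k into minus that of e k'. The resulting bound is a constant times an
  increment of \<open>k\<close>, which telescopes over adjacent cells.\<close>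

lemma regular_cell_error:
  fixes u u' u'' :: "real \<Rightarrow> real"
  assumes "a < b" "b < T" "0 < \<alpha>" "\<alpha> < 1"
    and du: "\<And>x. x \<in> {a..b} \<Longrightarrow> (u has_real_derivative u' x) (at x within {a..b})"
    and du': "\<And>x. x \<in> {a..b} \<Longrightarrow> (u' has_real_derivative u'' x) (at x within {a..b})"
    and bd: "\<And>x. x \<in> {a<..<b} \<Longrightarrow> \<bar>u'' x\<bar> \<le> M"
  obtains I where "((\<lambda>\<eta>. u' \<eta> / (T - \<eta>) powr \<alpha>) has_integral I) {a..b}"
    and "\<bar>I - (u b - u a) / (b - a) * (((T - a) powr (1 - \<alpha>) - (T - b) powr (1 - \<alpha>)) / (1 - \<alpha>))\<bar>
         \<le> M * (b - a)\<^sup>2 / 8 * ((T - b) powr (- \<alpha>) - (T - a) powr (- \<alpha>))"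
proof -
  define D where "D = (u b - u a) / (b - a)"
  define e where "e x = u x - u a - D * (x - a)" for x
  define k where "k x = (T - x) powr (- \<alpha>)" for x
  define k' where "k' x = \<alpha> * (T - x) powr (- \<alpha> - 1)" for x
  have e_bound: "\<bar>e x\<bar> \<le> M * (b - a)\<^sup>2 / 8" if "x \<in> {a..b}" for x
    using linear_interpolation_error(1)[OF \<open>a < b\<close> du du' bd that] unfolding e_def D_def by simp
  have e_ends: "e a = 0" "e b = 0"
    using \<open>a < b\<close> by (auto simp: e_def D_def)
  have de: "(e has_real_derivative u' x - D) (at x within {a..b})" if "x \<in> {a..b}" for x
    unfolding e_def using du[OF that] by (auto intro!: derivative_eq_intros)
  have dk: "(k has_real_derivative k' x) (at x within {a..b})" if "x \<in> {a..b}" for x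
    unfolding k_def k'_def using that \<open>b < T\<close> by (auto intro!: derivative_eq_intros)
  have cont_e: "continuous_on {a..b} e"
    using de by (rule DERIV_continuous_on)
  have cont_k': "continuous_on {a..b} k'"
    unfolding k'_def using \<open>b < T\<close> by (intro continuous_intros) auto
  have int_k': "(k' has_integral k b - k a) {a..b}"
    using \<open>a < b\<close> dk by (intro fundamental_theorem_of_calculus)
      (auto simp: has_real_derivative_iff_has_vector_derivative)
  have int_ek': "(\<lambda>x. e x * k' x) integrable_on {a..b}"
    by (intro integrable_continuous_real continuous_intros cont_e cont_k')
  \<comment> \<open>The integrand is the derivative of e k, whose boundary values are 0 by
    \<open>e_ends\<close>.\<close>
  have "((\<lambda>x. (u' x - D) * k x + e x * k' x) has_integral e b * k b - e a * k a) {a..b}"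
    using \<open>a < b\<close> unfolding has_real_derivative_iff_has_vector_derivative[symmetric]
    by (intro fundamental_theorem_of_calculus)
      (auto simp: has_real_derivative_iff_has_vector_derivative[symmetric] algebra_simps
            intro!: derivative_eq_intros de dk)
  from has_integral_diff[OF this integrable_integral[OF int_ek']]
  have "((\<lambda>x. (u' x - D) * k x) has_integral - integral {a..b} (\<lambda>x. e x * k' x)) {a..b}"
    by (simp add: e_ends)
  moreover have "((\<lambda>x. D * (1 / (T - x) powr \<alpha>)) has_integral
      D * (((T - a) powr (1 - \<alpha>) - (T - b) powr (1 - \<alpha>)) / (1 - \<alpha>))) {a..b}"
    using assms by (intro has_integral_mult_right has_integral_caputo_kernel) auto
  ultimately have "((\<lambda>x. (u' x - D) * k x + D * (1 / (T - x) powr \<alpha>)) has_integral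
      - integral {a..b} (\<lambda>x. e x * k' x)
      + D * (((T - a) powr (1 - \<alpha>) - (T - b) powr (1 - \<alpha>)) / (1 - \<alpha>))) {a..b}"
    by (rule has_integral_add)
  also have "(\<lambda>x. (u' x - D) * k x + D * (1 / (T - x) powr \<alpha>)) = (\<lambda>x. u' x / (T - x) powr \<alpha>)"
    by (simp add: k_def powr_minus divide_inverse algebra_simps)
  finally have int: "((\<lambda>x. u' x / (T - x) powr \<alpha>) has_integral
      - integral {a..b} (\<lambda>x. e x * k' x)
      + D * (((T - a) powr (1 - \<alpha>) - (T - b) powr (1 - \<alpha>)) / (1 - \<alpha>))) {a..b}" .
  have int_C: "((\<lambda>x. M * (b - a)\<^sup>2 / 8 * k' x) has_integral M * (b - a)\<^sup>2 / 8 * (k b - k a)) {a..b}"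
    by (intro has_integral_mult_right int_k')
  \<comment> \<open>As \<open>k'\<close> is nonnegative, the sup bound on \<open>e\<close> can be
    pulled out and the integral of \<open>k'\<close> is just \<open>k b - k a\<close>.\<close>
  have "norm (e x * k' x) \<le> M * (b - a)\<^sup>2 / 8 * k' x" if "x \<in> {a..b}" for x
  proof -
    have "k' x \<ge> 0"
      using \<open>0 < \<alpha>\<close> by (simp add: k'_def)
    with e_bound[OF that] show ?thesis
      unfolding real_norm_def abs_mult by (simp only: abs_of_nonneg mult_right_mono)
  qed
  then have "norm (integral {a..b} (\<lambda>x. e x * k' x)) \<le> integral {a..b} (\<lambda>x. M * (b - a)\<^sup>2 / 8 * k' x)"
    using int_ek' int_C by (intro integral_norm_bound_integral) (auto intro: has_integral_integrable)
  also have "\<dots> = M * (b - a)\<^sup>2 / 8 * (k b - k a)"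
    using int_C by (rule integral_unique)
  finally show ?thesis
    using that[OF int] by (simp add: D_def k_def)
qed

text \<open>Integration by parts is unsuitable here: for positive \<alpha> the kernel blows up at
  \<open>T\<close>, where the interpolation error is in general nonzero. The kernel itself is still
  integrable, so the slope error is bounded pointwise instead. The slope is taken over all of
  \<open>{a..b}\<close>, although the integral stops at \<open>T\<close>.\<close>

lemma singular_cell_error:
  fixes u u' u'' :: "real \<Rightarrow> real"
  assumes "a < T" "T \<le> b" "\<alpha> < 1"
    and du: "\<And>x. x \<in> {a..b} \<Longrightarrow> (u has_real_derivative u' x) (at x within {a..b})"
    and du': "\<And>x. x \<in> {a..b} \<Longrightarrow> (u' has_real_derivative u'' x) (at x within {a..b})"
    and bd: "\<And>x. x \<in> {a<..<b} \<Longrightarrow> \<bar>u'' x\<bar> \<le> M"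
  obtains I where "((\<lambda>\<eta>. u' \<eta> / (T - \<eta>) powr \<alpha>) has_integral I) {a..T}"
    and "\<bar>I - (u b - u a) / (b - a) * ((T - a) powr (1 - \<alpha>) / (1 - \<alpha>))\<bar>
         \<le> M * (b - a) / 2 * ((T - a) powr (1 - \<alpha>) / (1 - \<alpha>))"
proof -
  define D where "D = (u b - u a) / (b - a)"
  define k where "k x = 1 / (T - x) powr \<alpha>" for x
  define K where "K = (T - a) powr (1 - \<alpha>) / (1 - \<alpha>)"
  have int_k: "(k has_integral K) {a..T}"
    unfolding k_def K_def using has_integral_caputo_kernel[of a T T \<alpha>] assms by simp
  have slope: "\<bar>u' x - D\<bar> \<le> M * (b - a) / 2" if "x \<in> {a..T}" for x
    unfolding D_def using assms that
    by (intro linear_interpolation_error(2)[OF _ du du' bd]) auto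
  have "continuous_on {a..b} u'"
    using du' by (rule DERIV_continuous_on)
  then have cont: "continuous_on {a..T} u'"
    using \<open>T \<le> b\<close> by (auto intro: continuous_on_subset)
  \<comment> \<open>The integrand may be unbounded at \<open>T\<close>; it is integrable as the
    product of a bounded measurable function and an absolutely integrable one.\<close>
  have "k absolutely_integrable_on {a..T}"
    using int_k by (intro nonnegative_absolutely_integrable_1) (auto simp: k_def)
  moreover have "u' \<in> borel_measurable (lebesgue_on {a..T})"
    using cont by (intro continuous_imp_measurable_on_sets_lebesgue) auto
  moreover have "bounded (u' ` {a..T})"
    using cont by (intro compact_imp_bounded compact_continuous_image) auto
  ultimately have "(\<lambda>x. u' x * k x) integrable_on {a..T}"
    by (intro set_lebesgue_integral_eq_integral(1) absolutely_integrable_bounded_measurable_product_real) auto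
  then obtain I where I: "((\<lambda>x. u' x * k x) has_integral I) {a..T}"
    by blast
  have diff: "((\<lambda>x. u' x * k x - D * k x) has_integral I - D * K) {a..T}"
    by (intro has_integral_diff has_integral_mult_right I int_k)
  have bound: "((\<lambda>x. M * (b - a) / 2 * k x) has_integral M * (b - a) / 2 * K) {a..T}"
    by (intro has_integral_mult_right int_k)
  have "norm (u' x * k x - D * k x) \<le> M * (b - a) / 2 * k x" if "x \<in> {a..T}" for x
  proof -
    have "norm (u' x * k x - D * k x) = \<bar>u' x - D\<bar> * k x"
      by (simp add: diff_divide_distrib[symmetric] k_def)
    also have "\<dots> \<le> M * (b - a) / 2 * k x"
      using slope[OF that] by (intro mult_right_mono) (auto simp: k_def)
    finally show ?thesis .
  qed
  then have "norm (integral {a..T} (\<lambda>x. u' x * k x - D * k x)) \<le> integral {a..T} (\<lambda>x. M * (b - a) / 2 * k x)"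
    using diff bound by (intro integral_norm_bound_integral) (auto intro: has_integral_integrable)
  then have "\<bar>I - D * K\<bar> \<le> M * (b - a) / 2 * K"
    unfolding integral_unique[OF diff] integral_unique[OF bound] by simp
  with that[of I] I show ?thesis
    by (simp add: k_def K_def D_def)
qed

lemma regular_cells_error:
  fixes u u' u'' :: "real \<Rightarrow> real"
  assumes "\<tau> > 0" "0 < \<alpha>" "\<alpha> < 1" "real n * \<tau> < T"
    and du: "\<And>x. x \<in> {0..real n * \<tau>} \<Longrightarrow> (u has_real_derivative u' x) (at x within {0..real n * \<tau>})"
    and du': "\<And>x. x \<in> {0..real n * \<tau>} \<Longrightarrow> (u' has_real_derivative u'' x) (at x within {0..real n * \<tau>})"
    and bd: "\<And>x. x \<in> {0<..<real n * \<tau>} \<Longrightarrow> \<bar>u'' x\<bar> \<le> M"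
  shows "\<exists>I. ((\<lambda>\<eta>. u' \<eta> / (T - \<eta>) powr \<alpha>) has_integral I) {0..real n * \<tau>} \<and>
     \<bar>I - (\<Sum>s<n. (u (real (Suc s) * \<tau>) - u (real s * \<tau>)) / \<tau>
            * (((T - real s * \<tau>) powr (1 - \<alpha>) - (T - real (Suc s) * \<tau>) powr (1 - \<alpha>)) / (1 - \<alpha>)))\<bar>
     \<le> M * \<tau>\<^sup>2 / 8 * ((T - real n * \<tau>) powr (- \<alpha>) - T powr (- \<alpha>))"
  using assms(4-)
proof (induction n)
  case 0
  then show ?case by auto
next
  case (Suc n)
  have sub: "{0..real n * \<tau>} \<subseteq> {0..real (Suc n) * \<tau>}"
    and sub': "{real n * \<tau>..real (Suc n) * \<tau>} \<subseteq> {0..real (Suc n) * \<tau>}"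
    using \<open>\<tau> > 0\<close> by (auto simp: algebra_simps)
  define f where "f = (\<lambda>\<eta>. u' \<eta> / (T - \<eta>) powr \<alpha>)"
  have lt: "real n * \<tau> < real (Suc n) * \<tau>" "real (Suc n) * \<tau> - real n * \<tau> = \<tau>"
    using \<open>\<tau> > 0\<close> by (auto simp: algebra_simps)
  obtain I where I: "(f has_integral I) {0..real n * \<tau>}"
    and I_bd: "\<bar>I - (\<Sum>s<n. (u (real (Suc s) * \<tau>) - u (real s * \<tau>)) / \<tau>
            * (((T - real s * \<tau>) powr (1 - \<alpha>) - (T - real (Suc s) * \<tau>) powr (1 - \<alpha>)) / (1 - \<alpha>)))\<bar>
     \<le> M * \<tau>\<^sup>2 / 8 * ((T - real n * \<tau>) powr (- \<alpha>) - T powr (- \<alpha>))"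
  proof -
    have "(u has_real_derivative u' x) (at x within {0..real n * \<tau>})"
      and "(u' has_real_derivative u'' x) (at x within {0..real n * \<tau>})"
      if "x \<in> {0..real n * \<tau>}" for x
      using Suc.prems(2,3) sub that by (blast intro: DERIV_subset)+
    moreover have "\<bar>u'' x\<bar> \<le> M" if "x \<in> {0<..<real n * \<tau>}" for x
      using that lt by (intro Suc.prems(4)) auto
    ultimately show ?thesis
      using Suc.IH Suc.prems(1) lt that unfolding f_def by fastforce
  qed
  obtain J where J: "(f has_integral J) {real n * \<tau>..real (Suc n) * \<tau>}"
    and J_bd: "\<bar>J - (u (real (Suc n) * \<tau>) - u (real n * \<tau>)) / \<tau>
            * (((T - real n * \<tau>) powr (1 - \<alpha>) - (T - real (Suc n) * \<tau>) powr (1 - \<alpha>)) / (1 - \<alpha>))\<bar>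
     \<le> M * \<tau>\<^sup>2 / 8 * ((T - real (Suc n) * \<tau>) powr (- \<alpha>) - (T - real n * \<tau>) powr (- \<alpha>))"
  proof -
    have "(u has_real_derivative u' x) (at x within {real n * \<tau>..real (Suc n) * \<tau>})"
      and "(u' has_real_derivative u'' x) (at x within {real n * \<tau>..real (Suc n) * \<tau>})"
      if "x \<in> {real n * \<tau>..real (Suc n) * \<tau>}" for x
      using Suc.prems(2,3) sub' that by (blast intro: DERIV_subset)+
    moreover have "\<bar>u'' x\<bar> \<le> M" if "x \<in> {real n * \<tau><..<real (Suc n) * \<tau>}" for x
    proof (rule Suc.prems(4))
      have "0 \<le> real n * \<tau>" using \<open>\<tau> > 0\<close> by simp
      with that show "x \<in> {0<..<real (Suc n) * \<tau>}" by auto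
    qed
    ultimately show ?thesis
      using regular_cell_error[OF lt(1) Suc.prems(1) assms(2,3), of u u' u'' M] that
      unfolding f_def lt(2) by blast
  qed
  have "(f has_integral I + J) {0..real (Suc n) * \<tau>}"
    using lt \<open>\<tau> > 0\<close> by (intro has_integral_combine[OF _ _ I J]) auto
  moreover have "\<bar>I + J - (\<Sum>s<Suc n. (u (real (Suc s) * \<tau>) - u (real s * \<tau>)) / \<tau>
            * (((T - real s * \<tau>) powr (1 - \<alpha>) - (T - real (Suc s) * \<tau>) powr (1 - \<alpha>)) / (1 - \<alpha>)))\<bar>
     \<le> M * \<tau>\<^sup>2 / 8 * ((T - real (Suc n) * \<tau>) powr (- \<alpha>) - T powr (- \<alpha>))"
  proof -
    \<comment> \<open>After distributing the common factor \<open>p\<close>, the terms in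
      \<open>(T - real n * \<tau>) powr (- \<alpha>)\<close> of the two bounds cancel.\<close>
    define p where "p = M * \<tau>\<^sup>2 / 8"
    show ?thesis
      using I_bd J_bd unfolding sum.lessThan_Suc p_def[symmetric] right_diff_distrib[of p]
      by linarith
  qed
  ultimately show ?case
    unfolding f_def by blast
qed

section \<open>Matching the difference formula and assembling the estimate\<close>

lemma caputo_coeff_eq:
  assumes "\<tau> > 0" "s < j"
  shows "(mesh_point \<tau> (real j + 1/2) - real s * \<tau>) powr (1 - \<alpha>)
         - (mesh_point \<tau> (real j + 1/2) - real (Suc s) * \<tau>) powr (1 - \<alpha>)
         = \<tau> powr (1 - \<alpha>) * caputo_coeff \<alpha> (j - s)"
proof -
  have "mesh_point \<tau> (real j + 1/2) - real s * \<tau> = \<tau> * (real (j - s) + 1/2)"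
    "mesh_point \<tau> (real j + 1/2) - real (Suc s) * \<tau> = \<tau> * (real (j - s) - 1/2)"
    using assms by (auto simp: mesh_point_def algebra_simps of_nat_diff)
  \<comment> \<open>Because \<open>s < j\<close>, the index \<open>j - s\<close> is at least 1, so
    the second branch of \<open>caputo_coeff\<close> applies. Index 0 belongs to the final half
    cell.\<close>
  moreover have "real (j - s) - 1/2 \<ge> 0"
    using assms by linarith
  ultimately have "(mesh_point \<tau> (real j + 1/2) - real s * \<tau>) powr (1 - \<alpha>)
      = \<tau> powr (1 - \<alpha>) * (real (j - s) + 1/2) powr (1 - \<alpha>)"
    "(mesh_point \<tau> (real j + 1/2) - real (Suc s) * \<tau>) powr (1 - \<alpha>)
      = \<tau> powr (1 - \<alpha>) * (real (j - s) - 1/2) powr (1 - \<alpha>)"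
    using \<open>\<tau> > 0\<close> by (simp_all only: powr_mult)
  then show ?thesis
    using \<open>s < j\<close> unfolding caputo_coeff_def by (simp add: right_diff_distrib)
qed

text \<open>Splitting at \<open>a\<close>, the last mesh point before \<open>T\<close>, separates
  the regular cells (sum \<open>S\<close>) from the half cell (slope \<open>D\<close>). Working with
  explicit derivatives and any bound \<open>M\<close> keeps the supremum and the iterated
  \<open>deriv\<close> out of the estimate.\<close>

lemma caputo_minus_discrete_caputo_bound:
  fixes \<tau> \<alpha> :: real and j :: nat and u u' u'' :: "real \<Rightarrow> real"
  defines "L \<equiv> mesh_point \<tau> (real (j + 1))"
  assumes "\<tau> > 0" "0 < \<alpha>" "\<alpha> < 1"
    and du: "\<And>x. x \<in> {0..L} \<Longrightarrow> (u has_real_derivative u' x) (at x within {0..L})"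
    and du': "\<And>x. x \<in> {0..L} \<Longrightarrow> (u' has_real_derivative u'' x) (at x within {0..L})"
    and bd: "\<And>x. x \<in> {0<..<L} \<Longrightarrow> \<bar>u'' x\<bar> \<le> M"
  shows "\<bar>caputo \<alpha> (mesh_point \<tau> (real j + 1/2)) u - discrete_caputo \<alpha> \<tau> j u\<bar>
       \<le> 2 powr \<alpha> * M / (4 * Gamma (2 - \<alpha>)) * ((1 - \<alpha>) / 2 + 1) * \<tau> powr (2 - \<alpha>)"
proof -
  define T where "T = mesh_point \<tau> (real j + 1/2)"
  define a where "a = real j * \<tau>"
  define f where "f = (\<lambda>\<eta>. u' \<eta> / (T - \<eta>) powr \<alpha>)"
  have pts: "0 \<le> a" "T - a = \<tau> / 2" "L - a = \<tau>" "a < T" "T < L"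
    using \<open>\<tau> > 0\<close> by (auto simp: a_def T_def L_def mesh_point_def algebra_simps)
  have M: "M \<ge> 0"
    using bd[of "L / 2"] pts by fastforce
  define S where "S = (\<Sum>s<j. (u (real (Suc s) * \<tau>) - u (real s * \<tau>)) / \<tau>
            * (((T - real s * \<tau>) powr (1 - \<alpha>) - (T - real (Suc s) * \<tau>) powr (1 - \<alpha>)) / (1 - \<alpha>)))"
  obtain I where I: "(f has_integral I) {0..a}"
    and I_bd: "\<bar>I - S\<bar> \<le> M * \<tau>\<^sup>2 / 8 * ((\<tau> / 2) powr (- \<alpha>) - T powr (- \<alpha>))"
  proof -
    have "{0..a} \<subseteq> {0..L}"
      using pts by auto
    then have du_a: "(u has_real_derivative u' x) (at x within {0..a})"
      and du'_a: "(u' has_real_derivative u'' x) (at x within {0..a})"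
      if "x \<in> {0..a}" for x
      using du du' that by (blast intro: DERIV_subset)+
    have bd_a: "\<bar>u'' x\<bar> \<le> M" if "x \<in> {0<..<a}" for x
      using that pts by (intro bd) auto
    have "\<exists>I. (f has_integral I) {0..a} \<and>
        \<bar>I - S\<bar> \<le> M * \<tau>\<^sup>2 / 8 * ((T - a) powr (- \<alpha>) - T powr (- \<alpha>))"
      using regular_cells_error[OF assms(2-4) pts(4)[unfolded a_def]
          du_a[unfolded a_def] du'_a[unfolded a_def] bd_a[unfolded a_def]]
      unfolding f_def S_def a_def by simp
    with that show ?thesis
      unfolding pts(2) by blast
  qed
  define D where "D = (u (real (Suc j) * \<tau>) - u (real j * \<tau>)) / \<tau>"
  obtain J where J: "(f has_integral J) {a..T}"
    and J_bd: "\<bar>J - D * ((\<tau> / 2) powr (1 - \<alpha>) / (1 - \<alpha>))\<bar>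
               \<le> M * \<tau> / 2 * ((\<tau> / 2) powr (1 - \<alpha>) / (1 - \<alpha>))"
  proof -
    have "{a..L} \<subseteq> {0..L}"
      using pts by auto
    then have du_L: "(u has_real_derivative u' x) (at x within {a..L})"
      and du'_L: "(u' has_real_derivative u'' x) (at x within {a..L})"
      if "x \<in> {a..L}" for x
      using du du' that by (blast intro: DERIV_subset)+
    have bd_L: "\<bar>u'' x\<bar> \<le> M" if "x \<in> {a<..<L}" for x
      using that pts by (intro bd) auto
    have D: "(u L - u a) / \<tau> = D"
      by (simp add: D_def L_def a_def mesh_point_def add.commute)
    show ?thesis
      by (rule singular_cell_error[OF pts(4) less_imp_le[OF pts(5)] \<open>\<alpha> < 1\<close> du_L du'_L bd_L])
        (use that in \<open>auto simp: f_def pts(2,3) D\<close>)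
  qed
  have int_f: "(f has_integral I + J) {0..T}"
    using pts by (intro has_integral_combine[OF _ _ I J]) auto
  \<comment> \<open>\<open>deriv u\<close> is two-sided and may differ from the one-sided
    \<open>u'\<close> at 0; a finite set does not affect the integral.\<close>
  have f_eq: "deriv u \<eta> / (T - \<eta>) powr \<alpha> = f \<eta>" if "\<eta> \<in> {0..T} - {0, T}" for \<eta>
  proof -
    have "(u has_real_derivative u' \<eta>) (at \<eta>)"
      using du[of \<eta>] that pts at_within_Icc_at[of 0 \<eta> L] by auto
    then show ?thesis
      by (simp add: f_def DERIV_imp_deriv)
  qed
  have "((\<lambda>\<eta>. deriv u \<eta> / (T - \<eta>) powr \<alpha>) has_integral I + J) {0..T}"
    by (rule has_integral_spike_finite[of "{0, T}", OF _ f_eq int_f]) simp_all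
  then have caputo: "caputo \<alpha> T u = (I + J) / Gamma (1 - \<alpha>)"
    by (simp add: caputo_def integral_unique)
  have Gamma: "Gamma (2 - \<alpha>) = (1 - \<alpha>) * Gamma (1 - \<alpha>)"
  proof -
    have "1 - \<alpha> \<notin> \<int>\<^sub>\<le>\<^sub>0"
      using \<open>\<alpha> < 1\<close> by (auto dest: nonpos_Ints_nonpos)
    then show ?thesis
      using Gamma_plus1[of "1 - \<alpha>"] by simp
  qed
  have Gamma_pos: "Gamma (1 - \<alpha>) > 0" "Gamma (2 - \<alpha>) > 0"
    using \<open>\<alpha> < 1\<close> by (auto intro: Gamma_real_pos)
  have half: "(\<tau> / 2) powr (1 - \<alpha>) = \<tau> powr (1 - \<alpha>) * caputo_coeff \<alpha> 0"
    using \<open>\<tau> > 0\<close> by (simp add: caputo_coeff_def powr_divide)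
  have S: "(1 - \<alpha>) * S = \<tau> powr (1 - \<alpha>) * (\<Sum>s<j. caputo_coeff \<alpha> (j - s) *
      ((u (real (Suc s) * \<tau>) - u (real s * \<tau>)) / \<tau>))"
    unfolding S_def sum_distrib_left T_def using \<open>\<tau> > 0\<close> \<open>\<alpha> < 1\<close>
    by (intro sum.cong refl) (simp add: caputo_coeff_eq del: of_nat_Suc)
  \<comment> \<open>The term s = j is split off: by \<open>half\<close>, its coefficient is the
    kernel mass of the half cell. \<open>Gamma\<close> then absorbs the factor
    \<open>1 - \<alpha>\<close>.\<close>
  have "discrete_caputo \<alpha> \<tau> j u =
      ((1 - \<alpha>) * S + \<tau> powr (1 - \<alpha>) * (caputo_coeff \<alpha> 0 * D)) / Gamma (2 - \<alpha>)"
    unfolding S discrete_caputo_def D_def mesh_point_def atLeast0AtMost lessThan_Suc_atMost[symmetric]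
    by (simp add: distrib_left add_divide_distrib)
  also have "\<dots> = (S + D * ((\<tau> / 2) powr (1 - \<alpha>) / (1 - \<alpha>))) / Gamma (1 - \<alpha>)"
    unfolding half Gamma using \<open>\<alpha> < 1\<close> Gamma_pos by (simp add: field_simps)
  finally have "caputo \<alpha> T u - discrete_caputo \<alpha> \<tau> j u
      = ((I - S) + (J - D * ((\<tau> / 2) powr (1 - \<alpha>) / (1 - \<alpha>)))) / Gamma (1 - \<alpha>)"
    unfolding caputo by (simp add: diff_divide_distrib add_divide_distrib)
  then have "\<bar>caputo \<alpha> T u - discrete_caputo \<alpha> \<tau> j u\<bar>
      = \<bar>(I - S) + (J - D * ((\<tau> / 2) powr (1 - \<alpha>) / (1 - \<alpha>)))\<bar> / Gamma (1 - \<alpha>)"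
    using Gamma_pos by (simp only: abs_divide abs_of_pos)
  also have "\<dots> \<le> (M * \<tau>\<^sup>2 / 8 * (\<tau> / 2) powr (- \<alpha>)
      + M * \<tau> / 2 * ((\<tau> / 2) powr (1 - \<alpha>) / (1 - \<alpha>))) / Gamma (1 - \<alpha>)"
  proof (intro divide_right_mono)
    \<comment> \<open>The far end of the telescoped bound, a nonpositive term, is dropped.\<close>
    have "M * \<tau>\<^sup>2 / 8 * ((\<tau> / 2) powr (- \<alpha>) - T powr (- \<alpha>)) \<le> M * \<tau>\<^sup>2 / 8 * (\<tau> / 2) powr (- \<alpha>)"
      using M by (intro mult_left_mono) auto
    then show "\<bar>(I - S) + (J - D * ((\<tau> / 2) powr (1 - \<alpha>) / (1 - \<alpha>)))\<bar>
        \<le> M * \<tau>\<^sup>2 / 8 * (\<tau> / 2) powr (- \<alpha>) + M * \<tau> / 2 * ((\<tau> / 2) powr (1 - \<alpha>) / (1 - \<alpha>))"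
      using I_bd J_bd by linarith
  qed (use Gamma_pos in auto)
  also have "\<dots> = 2 powr \<alpha> * M / (4 * Gamma (2 - \<alpha>)) * ((1 - \<alpha>) / 2 + 1) * \<tau> powr (2 - \<alpha>)"
  proof -
    have p1: "(\<tau> / 2) powr (- \<alpha>) = 2 powr \<alpha> * \<tau> powr (- \<alpha>)"
      using \<open>\<tau> > 0\<close> by (simp add: powr_divide powr_minus field_simps)
    have p2: "(\<tau> / 2) powr (1 - \<alpha>) = \<tau> / 2 * (\<tau> / 2) powr (- \<alpha>)"
      using \<open>\<tau> > 0\<close> powr_add[of "\<tau> / 2" 1 "- \<alpha>"] by simp
    have p3: "\<tau> powr (2 - \<alpha>) = \<tau>\<^sup>2 * \<tau> powr (- \<alpha>)"
      using \<open>\<tau> > 0\<close> powr_add[of \<tau> 2 "- \<alpha>"] by simp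
    \<comment> \<open>What remains is rational, with w = 2^\<alpha>, q = \<tau>^(-\<alpha>), \<beta>
      = 1 - \<alpha> and G = Gamma(1 - \<alpha>): the regular cells give 1/8, the half cell
      1/(4\<beta>), and 1/8 + 1/(4\<beta>) = (\<beta>/2 + 1)/(4\<beta>).\<close>
    have "(M * \<tau>\<^sup>2 / 8 * (w * q) + M * \<tau> / 2 * (\<tau> / 2 * (w * q) / \<beta>)) / G
        = w * M / (4 * (\<beta> * G)) * (\<beta> / 2 + 1) * (\<tau>\<^sup>2 * q)"
      if "\<beta> \<noteq> 0" "G \<noteq> 0" for w q \<beta> G :: real
      using that by (simp add: field_simps power2_eq_square)
    then show ?thesis
      unfolding Gamma p2 p3 p1 by rule (use \<open>\<alpha> < 1\<close> Gamma_pos(1)[THEN less_imp_neq] in auto)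
  qed
  finally show ?thesis
    unfolding T_def .
qed

section \<open>The supremum of the second derivative as a pointwise bound\<close>

lemma abs_deriv2_le_sup:
  assumes du: "\<And>x. x \<in> {0..L} \<Longrightarrow> (u has_real_derivative u' x) (at x within {0..L})"
    and du': "\<And>x. x \<in> {0..L} \<Longrightarrow> (u' has_real_derivative u'' x) (at x within {0..L})"
    and cont: "continuous_on {0..L} u''"
    and x: "x \<in> {0<..<L}"
  shows "\<bar>u'' x\<bar> \<le> sup_abs_deriv2 L u"
proof -
  have deriv1: "deriv u y = u' y" if "y \<in> {0<..<L}" for y
    using du[of y] that at_within_Icc_at[of 0 y L] by (auto intro: DERIV_imp_deriv)
  have deriv2: "(deriv ^^ 2) u y = u'' y" if "y \<in> {0<..<L}" for y
  proof -
    \<comment> \<open>Differentiating \<open>deriv u\<close> at \<open>y\<close> requires its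
      agreement with \<open>u'\<close> on a whole neighbourhood, which the open interval
      provides.\<close>
    have "eventually (\<lambda>z. z \<in> {0<..<L}) (nhds y)"
      using that by (intro eventually_nhds_in_open) auto
    then have "eventually (\<lambda>z. deriv u z = u' z) (nhds y)"
      by eventually_elim (rule deriv1)
    then have "deriv (deriv u) y = deriv u' y"
      by (intro deriv_cong_ev) auto
    also have "\<dots> = u'' y"
      using du'[of y] that at_within_Icc_at[of 0 y L] by (auto intro: DERIV_imp_deriv)
    finally show ?thesis
      by (simp add: numeral_2_eq_2)
  qed
  \<comment> \<open>A real \<open>SUP\<close> is an upper bound only if the set is bounded above;
    continuity of \<open>u''\<close> on the compact closed interval ensures this.\<close>
  have "bounded (u'' ` {0..L})"
    using cont by (intro compact_imp_bounded compact_continuous_image) auto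
  then obtain B where "\<forall>y\<in>{0..L}. \<bar>u'' y\<bar> \<le> B"
    by (auto simp: bounded_iff simp del: atLeastAtMost_iff)
  then have "bdd_above ((\<lambda>t. \<bar>(deriv ^^ 2) u t\<bar>) ` {0<..<L})"
    by (intro bdd_aboveI2[of _ _ B]) (simp add: deriv2)
  from cSUP_upper[OF x this] show ?thesis
    unfolding sup_abs_deriv2_def using deriv2[OF x] by simp
qed

theorem lemma2:
  fixes \<tau> \<alpha> :: real and j :: nat and u :: "real \<Rightarrow> real"
  assumes "\<tau> > 0"
    and "0 < \<alpha>" and "\<alpha> < 1"
    and "C2_on_interval 0 (mesh_point \<tau> (real (j + 1))) u"
  shows "\<bar>caputo \<alpha> (mesh_point \<tau> (real j + 1/2)) u - discrete_caputo \<alpha> \<tau> j u\<bar>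
       \<le> 2 powr \<alpha> * sup_abs_deriv2 (mesh_point \<tau> (real (j + 1))) u / (4 * Gamma (2 - \<alpha>))
           * ((1 - \<alpha>) / 2 + 1) * \<tau> powr (2 - \<alpha>)"
proof -
  let ?L = "mesh_point \<tau> (real (j + 1))"
  obtain u' u'' where
    du: "\<And>x. x \<in> {0..?L} \<Longrightarrow> (u has_real_derivative u' x) (at x within {0..?L})" and
    du': "\<And>x. x \<in> {0..?L} \<Longrightarrow> (u' has_real_derivative u'' x) (at x within {0..?L})" and
    cont: "continuous_on {0..?L} u''"
    using assms(4) unfolding C2_on_interval_def by blast
  show ?thesis
    by (rule caputo_minus_discrete_caputo_bound[OF assms(1-3) du du' abs_deriv2_le_sup[OF du du' cont]])
qed

end
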